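(* There is a functor $L\colon\mathbf{Matr}\to\mathbf{GLat}$ that sends a matroid $M$ to its lattice $L(M)$ of flats ordered by inclusion, and sends a strong map $f\colon M\to N$ to the function $L(f)\colon L(M)\to L(N)$ given by $X\mapsto\mathrm{cl}(f(X))$.
   Context: All matroids are finite. A strong map from $M$ to $N$ is a function $f\colon|M|\to|N|$ between ground sets such that the inverse image of any flat of $N$ is a flat of $M$; $\mathbf{Matr}$ is the category of matroids and strong maps. $\mathrm{cl}$ denotes matroid closure. $\mathbf{GLat}$ is the category whose objects are (finite) geometric lattices and whose morphisms are functions that preserve joins (including the empty join, i.e. the least element) and that map every atom to either an atom or the least element. Isomorphic lattices are identified. *)

theory Defs
  imports "HOL-Algebra.Complete_Lattice" "HOL-Library.FuncSet"
begin

section \<open>Categories and functors\<close>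

text \<open>
  Morphisms are indexed by their source and target: \<open>Hom C A B\<close> need not be disjoint
  for different \<open>A\<close>, \<open>B\<close>, and \<open>Comp C A B D g f\<close> is the composite of
  \<open>f : A \<rightarrow> B\<close> and \<open>g : B \<rightarrow> D\<close>.
\<close>

record ('o, 'm) cat =
  Obj :: "'o set"
  Hom :: "'o \<Rightarrow> 'o \<Rightarrow> 'm set"
  Ident :: "'o \<Rightarrow> 'm"
  Comp :: "'o \<Rightarrow> 'o \<Rightarrow> 'o \<Rightarrow> 'm \<Rightarrow> 'm \<Rightarrow> 'm"

locale category =
  fixes C :: "('o, 'm) cat"
  assumes ident_hom: "A \<in> Obj C \<Longrightarrow> Ident C A \<in> Hom C A A"
    and comp_hom:
      "\<lbrakk>A \<in> Obj C; B \<in> Obj C; D \<in> Obj C; f \<in> Hom C A B; g \<in> Hom C B D\<rbrakk>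
        \<Longrightarrow> Comp C A B D g f \<in> Hom C A D"
    and ident_right:
      "\<lbrakk>A \<in> Obj C; B \<in> Obj C; f \<in> Hom C A B\<rbrakk> \<Longrightarrow> Comp C A A B f (Ident C A) = f"
    and ident_left:
      "\<lbrakk>A \<in> Obj C; B \<in> Obj C; f \<in> Hom C A B\<rbrakk> \<Longrightarrow> Comp C A B B (Ident C B) f = f"
    and comp_assoc:
      "\<lbrakk>A \<in> Obj C; B \<in> Obj C; D \<in> Obj C; E \<in> Obj C;
        f \<in> Hom C A B; g \<in> Hom C B D; h \<in> Hom C D E\<rbrakk>
        \<Longrightarrow> Comp C A D E h (Comp C A B D g f) = Comp C A B E (Comp C B D E h g) f"

locale cat_functor = source: category C + target: category D
  for C :: "('o, 'm) cat" and D :: "('p, 'n) cat" +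
  fixes Fo :: "'o \<Rightarrow> 'p"
    and Fm :: "'o \<Rightarrow> 'o \<Rightarrow> 'm \<Rightarrow> 'n"
  assumes map_obj: "A \<in> Obj C \<Longrightarrow> Fo A \<in> Obj D"
    and map_hom:
      "\<lbrakk>A \<in> Obj C; B \<in> Obj C; f \<in> Hom C A B\<rbrakk> \<Longrightarrow> Fm A B f \<in> Hom D (Fo A) (Fo B)"
    and map_ident: "A \<in> Obj C \<Longrightarrow> Fm A A (Ident C A) = Ident D (Fo A)"
    and map_comp:
      "\<lbrakk>A \<in> Obj C; B \<in> Obj C; E \<in> Obj C; f \<in> Hom C A B; g \<in> Hom C B E\<rbrakk>
        \<Longrightarrow> Fm A E (Comp C A B E g f) = Comp D (Fo A) (Fo B) (Fo E) (Fm B E g) (Fm A B f)"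

section \<open>Matroids and strong maps\<close>

record 'a matroid_data =
  ground :: "'a set"
  indep :: "'a set set"

locale matroid =
  fixes M :: "'a matroid_data"
  assumes finite_ground: "finite (ground M)"
    and indep_ground: "I \<in> indep M \<Longrightarrow> I \<subseteq> ground M"
    and indep_empty: "{} \<in> indep M"
    and indep_subset: "\<lbrakk>I \<in> indep M; J \<subseteq> I\<rbrakk> \<Longrightarrow> J \<in> indep M"
    and indep_augment:
      "\<lbrakk>I \<in> indep M; J \<in> indep M; card I < card J\<rbrakk>
        \<Longrightarrow> \<exists>x \<in> J - I. insert x I \<in> indep M"

definition mrank :: "'a matroid_data \<Rightarrow> 'a set \<Rightarrow> nat" where
  "mrank M X = Max (card ` {I \<in> indep M. I \<subseteq> X})"

definition mcl :: "'a matroid_data \<Rightarrow> 'a set \<Rightarrow> 'a set" where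
  "mcl M X = {x \<in> ground M. mrank M (insert x X) = mrank M X}"

definition flats :: "'a matroid_data \<Rightarrow> 'a set set" where
  "flats M = {X. X \<subseteq> ground M \<and> mcl M X = X}"

text \<open>
  Functions on a carrier are represented by their extensional representatives, so that
  equality in HOL is equality of functions on the carrier.
\<close>

definition strong_maps :: "'a matroid_data \<Rightarrow> 'b matroid_data \<Rightarrow> ('a \<Rightarrow> 'b) set" where
  "strong_maps M N = {f \<in> ground M \<rightarrow>\<^sub>E ground N.
     \<forall>X \<in> flats N. {x \<in> ground M. f x \<in> X} \<in> flats M}"

definition Matr :: "('a matroid_data, 'a \<Rightarrow> 'a) cat" where
  "Matr = \<lparr>Obj = {M. matroid M}, Hom = strong_maps,
     Ident = (\<lambda>M. \<lambda>x \<in> ground M. x),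
     Comp = (\<lambda>M N P g f. compose (ground M) g f)\<rparr>"

section \<open>Geometric lattices\<close>

definition covers :: "('a, 'b) gorder_scheme \<Rightarrow> 'a \<Rightarrow> 'a \<Rightarrow> bool" where
  "covers L y x \<longleftrightarrow> x \<in> carrier L \<and> y \<in> carrier L \<and> x \<sqsubset>\<^bsub>L\<^esub> y \<and>
     \<not> (\<exists>z \<in> carrier L. x \<sqsubset>\<^bsub>L\<^esub> z \<and> z \<sqsubset>\<^bsub>L\<^esub> y)"

definition atoms :: "('a, 'b) gorder_scheme \<Rightarrow> 'a set" where
  "atoms L = {a. covers L a \<bottom>\<^bsub>L\<^esub>}"

text \<open>
  A geometric lattice is a finite, atomistic, (upper) semimodular lattice. A finite
  nonempty lattice is bounded; \<^locale>\<open>lattice\<close> alone would allow the empty carrier.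
\<close>

locale geometric_lattice = bounded_lattice L for L (structure) +
  assumes finite_carrier: "finite (carrier L)"
    and atomistic: "x \<in> carrier L \<Longrightarrow> \<exists>A \<subseteq> atoms L. x = \<Squnion>A"
    and semimodular:
      "\<lbrakk>x \<in> carrier L; y \<in> carrier L; covers L x (x \<sqinter> y)\<rbrakk> \<Longrightarrow> covers L (x \<squnion> y) y"

text \<open>
  \<^const>\<open>sup_pres\<close> ranges over all subsets of the carrier, including the empty one, whose
  join is the least element. Its completeness requirement is automatic for finite bounded
  lattices.
\<close>

definition glat_maps :: "'a gorder \<Rightarrow> 'b gorder \<Rightarrow> ('a \<Rightarrow> 'b) set" where
  "glat_maps L K = {h \<in> carrier L \<rightarrow>\<^sub>E carrier K. sup_pres L K h \<and>
     (\<forall>a \<in> atoms L. h a \<in> atoms K \<or> h a = \<bottom>\<^bsub>K\<^esub>)}"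

definition GLat :: "('a gorder, 'a \<Rightarrow> 'a) cat" where
  "GLat = \<lparr>Obj = {L. geometric_lattice L}, Hom = glat_maps,
     Ident = (\<lambda>L. \<lambda>x \<in> carrier L. x),
     Comp = (\<lambda>L K J g f. compose (carrier L) g f)\<rparr>"

definition flat_lattice :: "'a matroid_data \<Rightarrow> 'a set gorder" where
  "flat_lattice M = \<lparr>carrier = flats M, eq = (=), le = (\<subseteq>)\<rparr>"

end

theory Submission
  imports Defs
begin

text \<open>
  Everything is an argument about the closure operator. Augmentation makes it monotone,
  idempotent and subject to the Steinitz exchange law. Idempotence and monotonicity give a
  complete lattice of flats, in which the join of a family is the closure of its union
  (\<open>sup_flat_lattice\<close>). Exchange identifies the flats covering a flat \<open>X\<close> as exactly
  the closures of \<open>X \<union> {e}\<close> with \<open>e \<notin> X\<close> (\<open>covers_flat_lattice_iff\<close>), from which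
  semimodularity and atomisticity are immediate: joining \<open>Y\<close> to a flat generated over
  \<open>X \<inter> Y\<close> by one element \<open>e\<close> is the same as adding \<open>e\<close> to \<open>Y\<close>.

  The morphism part rests on one identity. If \<open>f : M \<rightarrow> N\<close> is strong, the preimage of the flat
  \<open>cl (f S)\<close> is a flat containing \<open>S\<close>, hence contains \<open>cl S\<close>; therefore
  \<open>cl (f (cl S)) = cl (f S)\<close> (\<open>strong_map_mcl_image\<close>). So closures may be inserted and removed
  freely before applying \<open>f\<close>. Applied to unions this says that \<open>X \<mapsto> cl (f X)\<close> preserves joins,
  applied to singletons that it sends atoms to atoms or to the least element, and applied to
  an image \<open>f X\<close> that it is compatible with composition.
\<close>

section \<open>Concrete categories\<close>

text \<open>
  Both categories at hand consist of sets with structure and all functions satisfying some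
  condition, so only the closure of that condition under identities and composites depends
  on the structure; the equational laws hold because the functions are extensional.
\<close>

lemma concrete_categoryI:
  assumes funcs: "\<And>A B. Hom C A B \<subseteq> U A \<rightarrow>\<^sub>E U B"
    and ident: "\<And>A. Ident C A = (\<lambda>x \<in> U A. x)"
    and comp: "\<And>A B D g f. Comp C A B D g f = compose (U A) g f"
    and ident_hom: "\<And>A. A \<in> Obj C \<Longrightarrow> (\<lambda>x \<in> U A. x) \<in> Hom C A A"
    and comp_hom: "\<And>A B D f g.
      \<lbrakk>A \<in> Obj C; B \<in> Obj C; D \<in> Obj C; f \<in> Hom C A B; g \<in> Hom C B D\<rbrakk>
        \<Longrightarrow> compose (U A) g f \<in> Hom C A D"
  shows "category C"
proof
  have F: "f \<in> U A \<rightarrow> U B" "f \<in> extensional (U A)" if "f \<in> Hom C A B" for f A B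
    using subsetD[OF funcs that] by (auto simp: PiE_def)
  fix A B D E f g h
  show "A \<in> Obj C \<Longrightarrow> Ident C A \<in> Hom C A A"
    by (simp add: ident ident_hom)
  show "\<lbrakk>A \<in> Obj C; B \<in> Obj C; D \<in> Obj C; f \<in> Hom C A B; g \<in> Hom C B D\<rbrakk>
        \<Longrightarrow> Comp C A B D g f \<in> Hom C A D"
    by (simp add: comp comp_hom)
  show "Comp C A A B f (Ident C A) = f" if "f \<in> Hom C A B"
    unfolding comp ident by (rule compose_Id[OF F[OF that]])
  show "Comp C A B B (Ident C B) f = f" if "f \<in> Hom C A B"
    unfolding comp ident by (rule Id_compose[OF F[OF that]])
  show "Comp C A D E h (Comp C A B D g f) = Comp C A B E (Comp C B D E h g) f"
    if "f \<in> Hom C A B"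
    unfolding comp by (rule compose_assoc[OF F(1)[OF that]])
qed

section \<open>Matroid closure\<close>

definition basis_of :: "'a matroid_data \<Rightarrow> 'a set \<Rightarrow> 'a set \<Rightarrow> bool" where
  "basis_of M X B \<longleftrightarrow> B \<in> indep M \<and> B \<subseteq> X \<and> (\<forall>x \<in> X - B. insert x B \<notin> indep M)"

context matroid
begin

lemma finite_indep: "I \<in> indep M \<Longrightarrow> finite I"
  using indep_ground finite_ground finite_subset by blast

lemma finite_indep_sets: "finite {I \<in> indep M. I \<subseteq> X}"
proof (rule finite_subset)
  show "{I \<in> indep M. I \<subseteq> X} \<subseteq> Pow (ground M)"
    using indep_ground by blast
qed (simp add: finite_ground)

lemma card_le_mrank: "\<lbrakk>I \<in> indep M; I \<subseteq> X\<rbrakk> \<Longrightarrow> card I \<le> mrank M X"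
  unfolding mrank_def using finite_indep_sets by (intro Max_ge) auto

text \<open>
  This is where augmentation enters: a larger independent subset of \<open>X\<close> would extend \<open>B\<close>.
\<close>

lemma mrank_eq_card_basis:
  assumes "basis_of M X B"
  shows "mrank M X = card B"
proof (rule antisym)
  have B: "B \<in> indep M" "B \<subseteq> X" and max: "\<And>x. x \<in> X - B \<Longrightarrow> insert x B \<notin> indep M"
    using assms by (auto simp: basis_of_def)
  show "card B \<le> mrank M X"
    using B by (rule card_le_mrank)
  have "card I \<le> card B" if I: "I \<in> indep M" "I \<subseteq> X" for I
  proof (rule ccontr)
    assume "\<not> card I \<le> card B"
    then obtain x where "x \<in> I - B" "insert x B \<in> indep M"
      using indep_augment[OF B(1) I(1)] by auto
    with max I(2) show False by blast
  qed
  then show "mrank M X \<le> card B"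
    unfolding mrank_def using finite_indep_sets indep_empty
    by (subst Max_le_iff) auto
qed

lemma indep_extends_to_basis:
  assumes "I \<in> indep M" "I \<subseteq> X"
  obtains B where "basis_of M X B" "I \<subseteq> B"
proof -
  let ?S = "{J \<in> indep M. J \<subseteq> X \<and> I \<subseteq> J}"
  have "finite ?S"
    by (rule finite_subset[OF _ finite_indep_sets[of X]]) auto
  moreover have "?S \<noteq> {}"
    using assms by auto
  ultimately obtain B where B: "B \<in> ?S" and max: "\<And>J. J \<in> ?S \<Longrightarrow> B \<subseteq> J \<Longrightarrow> B = J"
    by (meson finite_has_maximal)
  have "insert x B \<notin> indep M" if "x \<in> X - B" for x
    using max[of "insert x B"] B that by auto
  with B that show thesis
    by (auto simp: basis_of_def)
qed

lemma obtain_basis: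
  obtains B where "basis_of M X B"
  using indep_extends_to_basis[OF indep_empty] by blast

text \<open>
  Adding \<open>x\<close> to \<open>X\<close> leaves the rank unchanged exactly when \<open>B\<close> is still a basis afterwards.
  This reduces statements about ranks to independence over one fixed basis.
\<close>

lemma mem_mcl_iff_basis:
  assumes B: "basis_of M X B"
  shows "x \<in> mcl M X \<longleftrightarrow> x \<in> ground M \<and> (x \<in> B \<or> insert x B \<notin> indep M)"
proof -
  have BX: "B \<in> indep M" "B \<subseteq> X"
    using B by (auto simp: basis_of_def)
  consider "x \<in> B" | "x \<notin> B" "insert x B \<in> indep M" | "insert x B \<notin> indep M"
    by blast
  then show ?thesis
  proof cases
    case 1
    then have "insert x X = X" using BX by blast
    with 1 show ?thesis by (simp add: mcl_def)
  next
    case 2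
    have "card (insert x B) \<le> mrank M (insert x X)"
      using 2 BX by (intro card_le_mrank) auto
    then have "mrank M X < mrank M (insert x X)"
      using 2 finite_indep[OF BX(1)] by (simp add: mrank_eq_card_basis[OF B])
    with 2 show ?thesis by (simp add: mcl_def)
  next
    case 3
    then have "basis_of M (insert x X) B"
      using B by (auto simp: basis_of_def)
    then show ?thesis
      using 3 B by (auto simp: mcl_def mrank_eq_card_basis)
  qed
qed

text \<open>
  Quantifying over all independent subsets, instead of fixing a basis, makes
  monotonicity in \<open>X\<close> visible.
\<close>

lemma mem_mcl_iff:
  "x \<in> mcl M X \<longleftrightarrow>
    x \<in> ground M \<and> (x \<in> X \<or> (\<exists>I \<in> indep M. I \<subseteq> X \<and> insert x I \<notin> indep M))"
  (is "_ \<longleftrightarrow> ?R")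
proof
  assume x: "x \<in> mcl M X"
  obtain B where B: "basis_of M X B" by (rule obtain_basis)
  then show ?R
    using x mem_mcl_iff_basis[OF B] by (auto simp: basis_of_def)
next
  assume R: ?R
  show "x \<in> mcl M X"
  proof (cases "x \<in> X")
    case True
    with R show ?thesis by (simp add: mcl_def insert_absorb)
  next
    case False
    with R obtain I where I: "I \<in> indep M" "I \<subseteq> X" "insert x I \<notin> indep M" by blast
    then obtain B where B: "basis_of M X B" "I \<subseteq> B"
      using indep_extends_to_basis by blast
    have "insert x B \<notin> indep M"
      using indep_subset I(3) B(2) by (meson insert_mono)
    with R B(1) show ?thesis by (simp add: mem_mcl_iff_basis)
  qed
qed

lemma mcl_ground: "mcl M X \<subseteq> ground M"
  by (auto simp: mcl_def)

lemma mcl_mono: "X \<subseteq> Y \<Longrightarrow> mcl M X \<subseteq> mcl M Y"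
  by (auto simp: mem_mcl_iff)

lemma mcl_extensive: "X \<subseteq> ground M \<Longrightarrow> X \<subseteq> mcl M X"
  by (auto simp: mem_mcl_iff)

text \<open>A basis of \<open>X\<close> remains maximal independent in the closure of \<open>X\<close>.\<close>

lemma mcl_idem:
  assumes "X \<subseteq> ground M"
  shows "mcl M (mcl M X) = mcl M X"
proof -
  obtain B where B: "basis_of M X B" by (rule obtain_basis)
  then have "basis_of M (mcl M X) B"
    using mcl_extensive[OF assms] by (auto simp: basis_of_def mem_mcl_iff_basis[OF B])
  then show ?thesis
    by (auto simp: mem_mcl_iff_basis[OF B] mem_mcl_iff_basis)
qed

lemma mcl_least:
  assumes "Y \<subseteq> ground M" "X \<subseteq> mcl M Y"
  shows "mcl M X \<subseteq> mcl M Y"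
  using mcl_mono[OF assms(2)] mcl_idem[OF assms(1)] by simp

lemma basis_of_insert:
  assumes "basis_of M X B" "insert x B \<in> indep M"
  shows "basis_of M (insert x X) (insert x B)"
  using assms indep_subset[of "insert z (insert x B)" "insert z B" for z]
  by (fastforce simp: basis_of_def)

text \<open>
  Steinitz exchange. Over a basis \<open>B\<close> of \<open>X\<close>, both \<open>x \<in> cl (X \<union> {y})\<close> and
  \<open>y \<in> cl (X \<union> {x})\<close> say that \<open>B \<union> {x, y}\<close> is dependent, a symmetric condition.
\<close>

lemma mcl_exchange:
  assumes X: "X \<subseteq> ground M" and x: "x \<in> ground M"
    and y: "y \<in> mcl M (insert x X)" "y \<notin> mcl M X"
  shows "x \<in> mcl M (insert y X)"
proof (cases "x = y")
  case True
  then show ?thesis using x by (simp add: mem_mcl_iff)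
next
  case False
  obtain B where B: "basis_of M X B" by (rule obtain_basis)
  have yg: "y \<in> ground M" using y(1) mcl_ground by blast
  have yB: "y \<notin> B" "insert y B \<in> indep M"
    using y(2) yg by (auto simp: mem_mcl_iff_basis[OF B])
  have "x \<notin> mcl M X"
    using y mcl_least[OF X, of "insert x X"] mcl_extensive[OF X] by blast
  then have xB: "insert x B \<in> indep M"
    using x by (auto simp: mem_mcl_iff_basis[OF B])
  have "insert y (insert x B) \<notin> indep M"
    using y(1) yB(1) False by (auto simp: mem_mcl_iff_basis[OF basis_of_insert[OF B xB]])
  then show ?thesis
    using x by (simp add: mem_mcl_iff_basis[OF basis_of_insert[OF B yB(2)]] insert_commute)
qed

section \<open>The lattice of flats\<close>

lemma mcl_flat: "X \<subseteq> ground M \<Longrightarrow> mcl M X \<in> flats M"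
  by (simp add: flats_def mcl_ground mcl_idem)

lemma flat_ground: "X \<in> flats M \<Longrightarrow> X \<subseteq> ground M"
  by (simp add: flats_def)

lemma mcl_of_flat: "X \<in> flats M \<Longrightarrow> mcl M X = X"
  by (simp add: flats_def)

lemma Union_flats_ground: "A \<subseteq> flats M \<Longrightarrow> \<Union>A \<subseteq> ground M"
  using flat_ground by blast

lemma mcl_subset_flat: "\<lbrakk>F \<in> flats M; X \<subseteq> F\<rbrakk> \<Longrightarrow> mcl M X \<subseteq> F"
  using mcl_mono mcl_of_flat by metis

lemma Inter_flats:
  assumes "A \<subseteq> flats M"
  shows "ground M \<inter> \<Inter>A \<in> flats M"
proof -
  have "mcl M (ground M \<inter> \<Inter>A) \<subseteq> F" if "F \<in> A" for F
    using assms that by (intro mcl_subset_flat) auto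
  then have "mcl M (ground M \<inter> \<Inter>A) \<subseteq> ground M \<inter> \<Inter>A"
    using mcl_ground by blast
  moreover have "ground M \<inter> \<Inter>A \<subseteq> mcl M (ground M \<inter> \<Inter>A)"
    by (rule mcl_extensive) auto
  ultimately show ?thesis
    by (auto simp: flats_def)
qed

text \<open>
  The join of flats generated by sets \<open>S i\<close> is generated by the union of the \<open>S i\<close>.
\<close>

lemma mcl_Union_mcl:
  assumes "\<And>i. i \<in> I \<Longrightarrow> S i \<subseteq> ground M"
  shows "mcl M (\<Union>i \<in> I. mcl M (S i)) = mcl M (\<Union>i \<in> I. S i)"
proof
  show "mcl M (\<Union>i \<in> I. mcl M (S i)) \<subseteq> mcl M (\<Union>i \<in> I. S i)"
    using assms by (intro mcl_least UN_least mcl_mono UN_upper) auto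
  show "mcl M (\<Union>i \<in> I. S i) \<subseteq> mcl M (\<Union>i \<in> I. mcl M (S i))"
    using assms mcl_extensive by (intro mcl_mono UN_mono) auto
qed

end

lemma flat_lattice_simps [simp]:
  "carrier (flat_lattice M) = flats M"
  "x \<sqsubseteq>\<^bsub>flat_lattice M\<^esub> y \<longleftrightarrow> x \<subseteq> y"
  "x .=\<^bsub>flat_lattice M\<^esub> y \<longleftrightarrow> x = y"
  "x \<sqsubset>\<^bsub>flat_lattice M\<^esub> y \<longleftrightarrow> x \<subset> y"
  by (auto simp: flat_lattice_def lless_def)

lemma partial_order_flat_lattice: "partial_order (flat_lattice M)"
  by unfold_locales (auto simp: flat_lattice_def)

context matroid
begin

lemma is_lub_flat_lattice:
  assumes "A \<subseteq> flats M"
  shows "is_lub (flat_lattice M) (mcl M (\<Union>A)) A"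
proof (rule least_UpperI)
  note U = Union_flats_ground[OF assms]
  show "x \<sqsubseteq>\<^bsub>flat_lattice M\<^esub> mcl M (\<Union>A)" if "x \<in> A" for x
    using mcl_extensive[OF U] that by auto
  show "mcl M (\<Union>A) \<sqsubseteq>\<^bsub>flat_lattice M\<^esub> y" if "y \<in> Upper (flat_lattice M) A" for y
  proof -
    have "y \<in> flats M" "\<Union>A \<subseteq> y"
      using that assms by (auto simp: Upper_def)
    then show ?thesis by (simp add: mcl_subset_flat)
  qed
  show "A \<subseteq> carrier (flat_lattice M)" "mcl M (\<Union>A) \<in> carrier (flat_lattice M)"
    using assms mcl_flat[OF U] by auto
qed

lemma is_glb_flat_lattice:
  assumes "A \<subseteq> flats M"
  shows "is_glb (flat_lattice M) (ground M \<inter> \<Inter>A) A"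
  using assms Inter_flats[OF assms] flat_ground
  by (intro greatest_LowerI) (auto simp: Lower_def)

lemma complete_lattice_flat_lattice: "complete_lattice (flat_lattice M)"
proof -
  interpret partial_order "flat_lattice M" by (rule partial_order_flat_lattice)
  show ?thesis
    using is_lub_flat_lattice is_glb_flat_lattice by unfold_locales auto
qed

lemma sup_flat_lattice:
  assumes "A \<subseteq> flats M"
  shows "\<Squnion>\<^bsub>flat_lattice M\<^esub>A = mcl M (\<Union>A)"
proof -
  interpret complete_lattice "flat_lattice M" by (rule complete_lattice_flat_lattice)
  show ?thesis
    using assms by (intro least_unique[OF weak.sup_lub is_lub_flat_lattice]) auto
qed

lemma meet_flat_lattice:
  assumes "X \<in> flats M" "Y \<in> flats M"
  shows "X \<sqinter>\<^bsub>flat_lattice M\<^esub> Y = X \<inter> Y"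
proof -
  interpret complete_lattice "flat_lattice M" by (rule complete_lattice_flat_lattice)
  have "ground M \<inter> \<Inter>{X, Y} = X \<inter> Y"
    using flat_ground assms by auto
  then show ?thesis
    unfolding meet_def
    using greatest_unique[OF weak.inf_glb is_glb_flat_lattice, of "{X, Y}"] assms by simp
qed

end

lemma sup_empty_eq_bottom: "\<Squnion>\<^bsub>L\<^esub>{} = \<bottom>\<^bsub>L\<^esub>"
  by (simp add: Lattice.sup_def bottom_def)

context matroid
begin

lemma bottom_flat_lattice: "\<bottom>\<^bsub>flat_lattice M\<^esub> = mcl M {}"
  using sup_flat_lattice[of "{}"] by (simp add: sup_empty_eq_bottom)

text \<open>
  The flats strictly between \<open>X\<close> and \<open>cl (X \<union> {e})\<close> are ruled out by exchange: a new
  element \<open>z\<close> of such a flat \<open>Z\<close> would give back \<open>e \<in> cl (X \<union> {z}) \<subseteq> Z\<close>.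
\<close>

lemma covers_flat_lattice_iff:
  assumes X: "X \<in> flats M"
  shows "covers (flat_lattice M) Y X \<longleftrightarrow> (\<exists>e \<in> ground M - X. Y = mcl M (insert e X))"
proof
  assume cov: "covers (flat_lattice M) Y X"
  then have Y: "Y \<in> flats M" and XY: "X \<subset> Y"
    and none: "\<And>Z. \<lbrakk>Z \<in> flats M; X \<subset> Z\<rbrakk> \<Longrightarrow> \<not> Z \<subset> Y"
    by (auto simp: covers_def)
  obtain e where e: "e \<in> Y" "e \<notin> X" using XY by blast
  have eg: "insert e X \<subseteq> ground M" using e XY Y flat_ground by blast
  have "X \<subset> mcl M (insert e X)"
    using mcl_extensive[OF eg] e by blast
  moreover have "mcl M (insert e X) \<subseteq> Y"
    using Y e XY by (intro mcl_subset_flat) auto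
  ultimately have "Y = mcl M (insert e X)"
    using none[OF mcl_flat[OF eg]] by blast
  with e eg show "\<exists>e \<in> ground M - X. Y = mcl M (insert e X)" by auto
next
  assume "\<exists>e \<in> ground M - X. Y = mcl M (insert e X)"
  then obtain e where e: "e \<in> ground M" "e \<notin> X" and Y: "Y = mcl M (insert e X)" by blast
  note Xg = flat_ground[OF X]
  have eg: "insert e X \<subseteq> ground M" using e Xg by simp
  have "X \<subset> Y" using mcl_extensive[OF eg] e Y by blast
  moreover have "\<not> Z \<subset> Y" if Z: "Z \<in> flats M" "X \<subset> Z" for Z
  proof
    assume ZY: "Z \<subset> Y"
    obtain z where z: "z \<in> Z" "z \<notin> X" using Z(2) by blast
    have "e \<in> mcl M (insert z X)"
      using z ZY Y mcl_of_flat[OF X] by (intro mcl_exchange[OF Xg e(1)]) auto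
    also have "\<dots> \<subseteq> Z"
      using z Z by (intro mcl_subset_flat) auto
    finally have "Y \<subseteq> Z"
      unfolding Y using Z by (intro mcl_subset_flat) auto
    with ZY show False by blast
  qed
  ultimately show "covers (flat_lattice M) Y X"
    using X mcl_flat[OF eg] Y by (auto simp: covers_def)
qed

text \<open>
  The covering criterion at the least flat \<open>cl {}\<close>: the loops it contains lie in every closed
  set, so \<open>e\<close> alone generates the same flat as \<open>e\<close> together with them.
\<close>

lemma mem_atoms_flat_lattice:
  "a \<in> atoms (flat_lattice M) \<longleftrightarrow> (\<exists>e \<in> ground M - mcl M {}. a = mcl M {e})"
proof -
  have "mcl M (insert e (mcl M {})) = mcl M {e}" if "e \<in> ground M" for e
    using mcl_Union_mcl[of "{{e}, {}}" "\<lambda>S. S"] that mcl_least[of "{e}" "insert e (mcl M {})"]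
      mcl_mono[of "{}" "{e}"] mcl_mono[of "{e}" "insert e (mcl M {})"] mcl_extensive[of "{e}"]
    by auto
  then show ?thesis
    using covers_flat_lattice_iff[OF mcl_flat[of "{}"]]
    by (auto simp: atoms_def bottom_flat_lattice)
qed

lemma mcl_singleton_atom_or_bottom:
  assumes "e \<in> ground M"
  shows "mcl M {e} \<in> atoms (flat_lattice M) \<or> mcl M {e} = \<bottom>\<^bsub>flat_lattice M\<^esub>"
proof (cases "e \<in> mcl M {}")
  case True
  then have "mcl M {e} = mcl M {}"
    using mcl_least[of "{}" "{e}"] mcl_mono[of "{}" "{e}"] by auto
  then show ?thesis by (simp add: bottom_flat_lattice)
qed (use assms mem_atoms_flat_lattice in blast)

text \<open>
  The atoms below a flat come from its non-loops; its loops belong to the closure of the empty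
  set and are therefore in every join, including the empty one.
\<close>

lemma flat_lattice_atomistic:
  assumes X: "X \<in> flats M"
  shows "\<exists>A \<subseteq> atoms (flat_lattice M). X = \<Squnion>\<^bsub>flat_lattice M\<^esub>A"
proof (intro exI conjI)
  let ?A = "(\<lambda>e. mcl M {e}) ` (X - mcl M {})"
  note Xg = flat_ground[OF X]
  show atoms: "?A \<subseteq> atoms (flat_lattice M)"
    using Xg mem_atoms_flat_lattice by auto
  have flats: "?A \<subseteq> flats M"
    using Xg by (auto intro!: mcl_flat)
  have "mcl M (\<Union>?A) = mcl M (X - mcl M {})"
    using Xg mcl_Union_mcl[of "X - mcl M {}" "\<lambda>e. {e}"] by auto
  also have "\<dots> = X"
  proof
    show "mcl M (X - mcl M {}) \<subseteq> X"
      using X by (intro mcl_subset_flat) auto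
    show "X \<subseteq> mcl M (X - mcl M {})"
      using mcl_mono[of "{}" "X - mcl M {}"] mcl_extensive[of "X - mcl M {}"] Xg by blast
  qed
  finally show "X = \<Squnion>\<^bsub>flat_lattice M\<^esub>?A"
    by (simp add: sup_flat_lattice[OF flats])
qed

lemma flat_lattice_semimodular:
  assumes X: "X \<in> flats M" and Y: "Y \<in> flats M"
    and cov: "covers (flat_lattice M) X (X \<sqinter>\<^bsub>flat_lattice M\<^esub> Y)"
  shows "covers (flat_lattice M) (X \<squnion>\<^bsub>flat_lattice M\<^esub> Y) Y"
proof -
  have cov': "covers (flat_lattice M) X (X \<inter> Y)"
    using cov by (simp add: meet_flat_lattice X Y)
  then have "X \<inter> Y \<in> flats M" by (simp add: covers_def)
  then obtain e where e: "e \<in> ground M" "e \<notin> X \<inter> Y" and Xe: "X = mcl M (insert e (X \<inter> Y))"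
    using cov' by (auto simp: covers_flat_lattice_iff)
  note Yg = flat_ground[OF Y]
  have eX: "e \<in> X"
    using mcl_extensive[of "insert e (X \<inter> Y)"] e Yg Xe by blast
  have "X \<squnion>\<^bsub>flat_lattice M\<^esub> Y = mcl M (X \<union> Y)"
    using X Y by (simp add: join_def sup_flat_lattice)
  also have "\<dots> = mcl M (insert e Y)"
  proof
    have "X \<subseteq> mcl M (insert e Y)"
      by (subst Xe) (rule mcl_mono, auto)
    moreover have "insert e Y \<subseteq> mcl M (insert e Y)"
      using e Yg by (intro mcl_extensive) auto
    ultimately show "mcl M (X \<union> Y) \<subseteq> mcl M (insert e Y)"
      using e Yg by (intro mcl_least) auto
    show "mcl M (insert e Y) \<subseteq> mcl M (X \<union> Y)"
      using eX by (intro mcl_mono) auto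
  qed
  finally show ?thesis
    using e eX by (auto simp: covers_flat_lattice_iff[OF Y])
qed

lemma geometric_lattice_flat_lattice: "geometric_lattice (flat_lattice M)"
proof -
  interpret complete_lattice "flat_lattice M" by (rule complete_lattice_flat_lattice)
  show ?thesis
  proof
    show "finite (carrier (flat_lattice M))"
      using finite_subset[of "flats M" "Pow (ground M)"] flat_ground finite_ground by auto
  qed (use flat_lattice_atomistic flat_lattice_semimodular in auto)
qed

end

section \<open>Strong maps\<close>

text \<open>The preimage of the flat \<open>cl (f S)\<close> is a flat that contains \<open>S\<close>, hence \<open>cl S\<close>.\<close>

lemma strong_map_mcl_image:
  assumes M: "matroid M" and N: "matroid N" and f: "f \<in> strong_maps M N"
    and S: "S \<subseteq> ground M"
  shows "mcl N (f ` mcl M S) = mcl N (f ` S)"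
proof
  interpret M: matroid M by (rule M)
  interpret N: matroid N by (rule N)
  have fS: "f ` S \<subseteq> ground N" using f S by (auto simp: strong_maps_def)
  let ?P = "{x \<in> ground M. f x \<in> mcl N (f ` S)}"
  have "?P \<in> flats M"
    using f N.mcl_flat[OF fS] by (simp add: strong_maps_def)
  moreover have "S \<subseteq> ?P"
    using S N.mcl_extensive[OF fS] by auto
  ultimately have "mcl M S \<subseteq> ?P"
    by (rule M.mcl_subset_flat)
  then show "mcl N (f ` mcl M S) \<subseteq> mcl N (f ` S)"
    using fS by (intro N.mcl_least) auto
  show "mcl N (f ` S) \<subseteq> mcl N (f ` mcl M S)"
    using M.mcl_extensive[OF S] by (intro N.mcl_mono) auto
qed

lemma strong_map_glat_map:
  assumes M: "matroid M" and N: "matroid N" and f: "f \<in> strong_maps M N"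
  shows "(\<lambda>X \<in> flats M. mcl N (f ` X)) \<in> glat_maps (flat_lattice M) (flat_lattice N)"
proof -
  interpret M: matroid M by (rule M)
  interpret N: matroid N by (rule N)
  let ?h = "\<lambda>X \<in> flats M. mcl N (f ` X)"
  have fg: "f ` S \<subseteq> ground N" if "S \<subseteq> ground M" for S
    using f that by (auto simp: strong_maps_def)
  have h: "?h \<in> flats M \<rightarrow>\<^sub>E flats N"
    using fg M.flat_ground N.mcl_flat by auto
  have "?h (\<Squnion>\<^bsub>flat_lattice M\<^esub>A) = \<Squnion>\<^bsub>flat_lattice N\<^esub>(?h ` A)" if A: "A \<subseteq> flats M" for A
  proof -
    note U = M.Union_flats_ground[OF A]
    have hA: "?h ` A = (\<lambda>X. mcl N (f ` X)) ` A"
      using A by (intro image_cong) auto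
    have "?h (\<Squnion>\<^bsub>flat_lattice M\<^esub>A) = mcl N (f ` mcl M (\<Union>A))"
      using A U by (simp add: M.sup_flat_lattice M.mcl_flat)
    also have "\<dots> = mcl N (f ` \<Union>A)"
      by (rule strong_map_mcl_image[OF M N f U])
    also have "\<dots> = mcl N (\<Union>X \<in> A. mcl N (f ` X))"
      using A fg M.flat_ground by (subst N.mcl_Union_mcl) (auto simp: image_Union)
    also have "\<dots> = \<Squnion>\<^bsub>flat_lattice N\<^esub>(?h ` A)"
      using A unfolding hA
      by (subst N.sup_flat_lattice) (auto intro!: N.mcl_flat fg dest: M.flat_ground)
    finally show ?thesis .
  qed
  then have "sup_pres (flat_lattice M) (flat_lattice N) ?h"
    using M.complete_lattice_flat_lattice N.complete_lattice_flat_lattice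
    by (simp add: sup_pres_def)
  moreover have "?h a \<in> atoms (flat_lattice N) \<or> ?h a = \<bottom>\<^bsub>flat_lattice N\<^esub>"
    if "a \<in> atoms (flat_lattice M)" for a
  proof -
    obtain e where e: "e \<in> ground M" "a = mcl M {e}"
      using \<open>a \<in> _\<close> M.mem_atoms_flat_lattice by blast
    then have "?h a = mcl N {f e}"
      using strong_map_mcl_image[OF M N f, of "{e}"] M.mcl_flat[of "{e}"] by simp
    then show ?thesis
      using N.mcl_singleton_atom_or_bottom[of "f e"] fg[of "{e}"] e(1) by auto
  qed
  ultimately show ?thesis
    using h by (simp add: glat_maps_def)
qed

section \<open>The two categories and the functor\<close>

lemma category_Matr: "category Matr"
proof (rule concrete_categoryI[where U = ground])
  fix A :: "'a matroid_data"
  have "{x \<in> ground A. (if x \<in> ground A then x else undefined) \<in> X} = X" if "X \<in> flats A" for X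
    using that by (auto simp: flats_def)
  then show "(\<lambda>x \<in> ground A. x) \<in> Hom Matr A A"
    by (auto simp: Matr_def strong_maps_def restrict_def)
next
  fix A B D :: "'a matroid_data" and f g
  assume fg: "f \<in> Hom Matr A B" "g \<in> Hom Matr B D"
  then have f: "f \<in> ground A \<rightarrow>\<^sub>E ground B" and g: "g \<in> ground B \<rightarrow>\<^sub>E ground D"
    by (auto simp: Matr_def strong_maps_def)
  have "{x \<in> ground A. compose (ground A) g f x \<in> X} \<in> flats A" if "X \<in> flats D" for X
  proof -
    have "{x \<in> ground A. compose (ground A) g f x \<in> X}
        = {x \<in> ground A. f x \<in> {y \<in> ground B. g y \<in> X}}"
      using f by (auto simp: compose_def)
    moreover have "{y \<in> ground B. g y \<in> X} \<in> flats B"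
      using fg(2) that by (simp add: Matr_def strong_maps_def)
    then have "{x \<in> ground A. f x \<in> {y \<in> ground B. g y \<in> X}} \<in> flats A"
      using fg(1) unfolding Matr_def strong_maps_def by auto
    ultimately show ?thesis by (simp only:)
  qed
  then show "compose (ground A) g f \<in> Hom Matr A D"
    using f g by (auto simp: Matr_def strong_maps_def compose_def)
qed (auto simp: Matr_def strong_maps_def)

lemma finite_bounded_lattice_complete:
  assumes "bounded_lattice L" "finite (carrier L)"
  shows "complete_lattice L"
proof -
  interpret bounded_lattice L by (rule assms(1))
  show ?thesis
  proof
    fix A assume A: "A \<subseteq> carrier L"
    then have fin: "finite A" using assms(2) finite_subset by blast
    show "\<exists>s. is_lub L s A"
      using finite_sup_least[OF fin A] bottom_least by (cases "A = {}") auto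
    show "\<exists>i. is_glb L i A"
      using finite_inf_greatest[OF fin A] top_greatest by (cases "A = {}") auto
  qed
qed

text \<open>
  An atom may be collapsed to the least element by \<open>f\<close>; preservation of the empty join by \<open>g\<close>
  keeps it there.
\<close>

lemma compose_glat_maps:
  assumes f: "f \<in> glat_maps L K" and g: "g \<in> glat_maps K J"
  shows "compose (carrier L) g f \<in> glat_maps L J"
proof -
  have fc: "f \<in> carrier L \<rightarrow>\<^sub>E carrier K" and gc: "g \<in> carrier K \<rightarrow>\<^sub>E carrier J"
    and fs: "sup_pres L K f" and gs: "sup_pres K J g"
    using f g by (auto simp: glat_maps_def)
  interpret L: complete_lattice L using fs by (simp add: sup_pres_def)
  have "compose (carrier L) g f (\<Squnion>\<^bsub>L\<^esub>A) = \<Squnion>\<^bsub>J\<^esub>(compose (carrier L) g f ` A)"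
    if A: "A \<subseteq> carrier L" for A
  proof -
    \<comment> \<open>Extensional composites agree with ordinary ones only inside the carrier.\<close>
    have "compose (carrier L) g f ` A = g ` f ` A"
      using A by (force simp: compose_def)
    moreover have "f ` A \<subseteq> carrier K" using A fc by auto
    moreover have "\<Squnion>\<^bsub>L\<^esub>A \<in> carrier L" using A by simp
    ultimately show ?thesis
      using fs gs A by (simp add: sup_pres_def compose_eq)
  qed
  then have "sup_pres L J (compose (carrier L) g f)"
    using fs gs by (simp add: sup_pres_def)
  moreover have "g \<bottom>\<^bsub>K\<^esub> = \<bottom>\<^bsub>J\<^esub>"
    using gs by (auto simp: sup_pres_def simp flip: sup_empty_eq_bottom)
  then have "compose (carrier L) g f a \<in> atoms J \<or> compose (carrier L) g f a = \<bottom>\<^bsub>J\<^esub>"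
    if a: "a \<in> atoms L" for a
  proof -
    have "a \<in> carrier L" using a by (simp add: atoms_def covers_def)
    moreover have "f a \<in> atoms K \<or> f a = \<bottom>\<^bsub>K\<^esub>" using f a by (simp add: glat_maps_def)
    ultimately show ?thesis
      using g \<open>g \<bottom>\<^bsub>K\<^esub> = _\<close> by (auto simp: glat_maps_def compose_eq)
  qed
  ultimately show ?thesis
    using fc gc by (auto simp: glat_maps_def compose_def)
qed

lemma category_GLat: "category GLat"
proof (rule concrete_categoryI[where U = carrier])
  fix L :: "'a gorder"
  assume "L \<in> Obj GLat"
  then interpret geometric_lattice L by (simp add: GLat_def)
  interpret complete_lattice L
    by (rule finite_bounded_lattice_complete[OF bounded_lattice_axioms finite_carrier])
  have "(\<lambda>x \<in> carrier L. x) ` A = A" if "A \<subseteq> carrier L" for A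
    using that by force
  then have "sup_pres L L (\<lambda>x \<in> carrier L. x)"
    using complete_lattice_axioms by (simp add: sup_pres_def)
  then show "(\<lambda>x \<in> carrier L. x) \<in> Hom GLat L L"
    by (auto simp: GLat_def glat_maps_def atoms_def covers_def)
qed (auto simp: GLat_def compose_glat_maps, auto simp: glat_maps_def)

theorem proposition7p4:
  shows "\<exists>(Lo :: 'a matroid_data \<Rightarrow> 'a set gorder)
           (Lm :: 'a matroid_data \<Rightarrow> 'a matroid_data \<Rightarrow> ('a \<Rightarrow> 'a) \<Rightarrow> ('a set \<Rightarrow> 'a set)).
      cat_functor Matr GLat Lo Lm \<and>
      (\<forall>M \<in> Obj Matr. Lo M = flat_lattice M) \<and>
      (\<forall>M \<in> Obj Matr. \<forall>N \<in> Obj Matr. \<forall>f \<in> Hom Matr M N.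
         Lm M N f = (\<lambda>X \<in> flats M. mcl N (f ` X)))"
proof (intro exI conjI)
  let ?Lm = "\<lambda>M N f. \<lambda>X \<in> flats M. mcl N (f ` X)"
  show "cat_functor Matr GLat flat_lattice (?Lm :: 'a matroid_data \<Rightarrow> _)"
  proof (intro cat_functor.intro category_Matr category_GLat cat_functor_axioms.intro)
    fix M N P :: "'a matroid_data" and f g
    show "flat_lattice M \<in> Obj GLat" if "M \<in> Obj Matr"
      using that by (simp add: Matr_def GLat_def matroid.geometric_lattice_flat_lattice)
    show "?Lm M N f \<in> Hom GLat (flat_lattice M) (flat_lattice N)"
      if "M \<in> Obj Matr" "N \<in> Obj Matr" "f \<in> Hom Matr M N"
      using that strong_map_glat_map by (simp add: Matr_def GLat_def)
    show "?Lm M M (Ident Matr M) = Ident GLat (flat_lattice M)" if "M \<in> Obj Matr"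
    proof -
      have "mcl M ((\<lambda>x \<in> ground M. x) ` X) = X" if "X \<in> flats M" for X
      proof -
        have "(\<lambda>x \<in> ground M. x) ` X = X"
          using that by (force simp: flats_def)
        with that show ?thesis by (simp add: flats_def)
      qed
      then show ?thesis
        by (auto simp: Matr_def GLat_def intro!: restrict_ext)
    qed
    show "?Lm M P (Comp Matr M N P g f)
        = Comp GLat (flat_lattice M) (flat_lattice N) (flat_lattice P) (?Lm N P g) (?Lm M N f)"
      if "M \<in> Obj Matr" "N \<in> Obj Matr" "P \<in> Obj Matr" "f \<in> Hom Matr M N" "g \<in> Hom Matr N P"
    proof -
      have M: "matroid M" and N: "matroid N" and P: "matroid P"
        and f: "f \<in> strong_maps M N" and g: "g \<in> strong_maps N P"
        using that by (auto simp: Matr_def)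
      \<comment> \<open>The closure in \<open>N\<close> taken between the two maps is absorbed by the closure in \<open>P\<close>.\<close>
      have "mcl P (compose (ground M) g f ` X) = ?Lm N P g (?Lm M N f X)" if X: "X \<in> flats M" for X
      proof -
        have Xg: "X \<subseteq> ground M" using X by (simp add: flats_def)
        then have fX: "f ` X \<subseteq> ground N" using f by (auto simp: strong_maps_def)
        have "compose (ground M) g f ` X = g ` f ` X"
          using Xg by (force simp: compose_def)
        then show ?thesis
          using X strong_map_mcl_image[OF N P g fX] matroid.mcl_flat[OF N fX] by simp
      qed
      then show ?thesis
        by (auto simp: Matr_def GLat_def compose_def intro!: restrict_ext)
    qed
  qed
qed auto

end
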